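(* Let $r_1,\dots,r_n$ be natural numbers and let $x_1,\dots,x_n$ be pairwise distinct non-negative real numbers. Put $m:=\sum_{i=1}^n r_i$ and, for $1\le i\le n$ and $1\le j\le r_i$, $$a_{ij}:=\frac{\prod_{1\le \ell\le r_i,\ \ell\neq j}\ell\ \cdot\prod_{1\le k\le n,\ k\neq i}r_k!\,x_k^{r_k}}{\prod_{1\le \ell\le r_i,\ \ell\neq j}(\ell-j)\ \cdot\prod_{1\le k\le n,\ k\neq i}\ \prod_{\ell=1}^{r_k}(\ell x_k-jx_i)}.$$ Then $$\prod_{i=1}^n\prod_{j=1}^{r_i}(1+jx_i)^{a_{ij}}\leq\exp\left(\frac{1}{m}\prod_{i=1}^n r_i!\,x_i^{r_i}\right).$$ Moreover, equality holds only when one $x_i$ equals zero.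
   Context: Here $n$ is a positive integer, and empty products are equal to $1$.
   Formalization: The formal theorem also assumes that every denominator of a_{ij} is nonzero and that m > 0; pairwise distinct x_i do not ensure the former (n=2, r=(2,1), x=(1,2) makes a_{12} undefined). *)

theory Defs
  imports Complex_Main
begin

definition expo_num :: "nat \<Rightarrow> (nat \<Rightarrow> nat) \<Rightarrow> (nat \<Rightarrow> real) \<Rightarrow> nat \<Rightarrow> nat \<Rightarrow> real" where
  "expo_num n r x i j =
     (\<Prod>l\<in>{1..r i} - {j}. real l) * (\<Prod>k\<in>{1..n} - {i}. fact (r k) * x k ^ r k)"

definition expo_den :: "nat \<Rightarrow> (nat \<Rightarrow> nat) \<Rightarrow> (nat \<Rightarrow> real) \<Rightarrow> nat \<Rightarrow> nat \<Rightarrow> real" where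
  "expo_den n r x i j =
     (\<Prod>l\<in>{1..r i} - {j}. real l - real j) *
     (\<Prod>k\<in>{1..n} - {i}. \<Prod>l=1..r k. real l * x k - real j * x i)"

text \<open>
  Pairwise distinctness of the \<open>x i\<close> does not make \<open>expo_den\<close> nonzero:
  take \<open>n = 2\<close>, \<open>r 1 = 2\<close>, \<open>r 2 = 1\<close>, \<open>x 1 = 1\<close>, \<open>x 2 = 2\<close>. The inequality itself then
  fails under the convention \<open>t / 0 = 0\<close>, so statements about \<open>expo\<close> need nonzero
  denominators as a hypothesis.
\<close>

definition expo :: "nat \<Rightarrow> (nat \<Rightarrow> nat) \<Rightarrow> (nat \<Rightarrow> real) \<Rightarrow> nat \<Rightarrow> nat \<Rightarrow> real" where
  "expo n r x i j = expo_num n r x i j / expo_den n r x i j"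

end

(* For positive, pairwise distinct nodes y_p = j * x_i the exponents are the Lagrange
   coefficients a_p = prod_{q \<noteq> p} y_q / (y_q - y_p), and partial fractions give
   sum_p a_p * y_p / (1 + s * y_p) = s^(m-1) * prod_p y_p / prod_p (1 + s * y_p).
   Integrated over s in [0, 1], the left-hand side is the logarithm of the product to be bounded,
   while for s > 0 the right-hand side is strictly below s^(m-1) * prod_p y_p, whose integral is
   prod_p y_p / m.  If some x_i with r_i > 0 vanishes, both sides of the inequality are 1. *)
theory Submission imports Defs begin

text \<open>Adding a node \<open>w\<close> multiplies the summand at \<open>p\<close> by 1 / (y_w -
  y_p), and 1 / ((y_w - y_p) (y_p - t)) = (1 / (y_p - t) - 1 / (y_p - y_w)) / (y_w - t), which
  reduces everything to sums over the old nodes.\<close>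

lemma partial_fractions_simple_roots:
  fixes y :: "'a \<Rightarrow> 'b::field"
  assumes "finite I" "I \<noteq> {}" "inj_on y I" "t \<notin> y ` I"
  shows "(\<Sum>p\<in>I. 1 / ((\<Prod>q\<in>I - {p}. y q - y p) * (y p - t))) = 1 / (\<Prod>q\<in>I. y q - t)"
  using assms
proof (induction I arbitrary: t rule: finite_ne_induct)
  case (singleton w)
  then show ?case by simp
next
  case (insert w S)
  define D where "D p = (\<Prod>q\<in>S - {p}. y q - y p)" for p
  have inj: "inj_on y S" and wS: "y w \<notin> y ` S" and tS: "t \<notin> y ` S" and wt: "y w \<noteq> t"
    using insert.prems insert.hyps by auto
  \<comment> \<open>The hypothesis is used twice, at \<open>t\<close> and at the new node
    \<open>y w\<close>; hence the induction over arbitrary \<open>t\<close>.\<close>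
  have IHt: "(\<Sum>p\<in>S. 1 / (D p * (y p - t))) = 1 / (\<Prod>q\<in>S. y q - t)"
    and IHw: "(\<Sum>p\<in>S. 1 / (D p * (y p - y w))) = 1 / (\<Prod>q\<in>S. y q - y w)"
    using insert.IH[OF inj] tS wS by (simp_all add: D_def)
  have split_term: "1 / ((\<Prod>q\<in>insert w S - {p}. y q - y p) * (y p - t))
      = (1 / (D p * (y p - t)) - 1 / (D p * (y p - y w))) / (y w - t)" if "p \<in> S" for p
  proof -
    have "insert w S - {p} = insert w (S - {p})"
      using that insert.hyps by auto
    then have "(\<Prod>q\<in>insert w S - {p}. y q - y p) = (y w - y p) * D p"
      using insert.hyps by (simp add: D_def)
    moreover have "y p \<noteq> t" "y p \<noteq> y w"
      using that tS wS by (metis imageI)+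
    moreover have "D p \<noteq> 0"
      using that inj insert.hyps by (auto simp: D_def inj_on_def)
    ultimately show ?thesis
      using wt by (simp add: divide_simps) (simp add: algebra_simps)
  qed
  have "(\<Sum>p\<in>insert w S. 1 / ((\<Prod>q\<in>insert w S - {p}. y q - y p) * (y p - t)))
      = 1 / ((\<Prod>q\<in>S. y q - y w) * (y w - t))
        + (\<Sum>p\<in>S. (1 / (D p * (y p - t)) - 1 / (D p * (y p - y w))) / (y w - t))"
    using insert.hyps split_term by (simp add: insert_Diff_if)
  also have "(\<Sum>p\<in>S. (1 / (D p * (y p - t)) - 1 / (D p * (y p - y w))) / (y w - t))
      = (1 / (\<Prod>q\<in>S. y q - t) - 1 / (\<Prod>q\<in>S. y q - y w)) / (y w - t)"
    by (simp only: sum_divide_distrib[symmetric] sum_subtractf IHt IHw)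
  \<comment> \<open>The summand of \<open>w\<close> itself cancels the part that came from
    evaluating at \<open>y w\<close>.\<close>
  also have "1 / ((\<Prod>q\<in>S. y q - y w) * (y w - t)) + \<dots> = 1 / (\<Prod>q\<in>insert w S. y q - t)"
    using insert.hyps by (simp add: diff_divide_distrib mult.commute)
  finally show ?case .
qed

text \<open>Partial fractions at t = -1/s, because 1 + s * y_p = s * (y_p - t). As t is negative, it
  is not a node. The denominators contribute \<open>s ^ card I\<close>, and one factor s is lost in
  rescaling the summands.\<close>

lemma sum_lagrange_coeff_rational:
  fixes y :: "'a \<Rightarrow> real"
  assumes "finite I" "I \<noteq> {}" "inj_on y I" "\<And>p. p \<in> I \<Longrightarrow> y p > 0" "s > 0"
  shows "(\<Sum>p\<in>I. (\<Prod>q\<in>I - {p}. y q / (y q - y p)) * (y p / (1 + s * y p)))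
     = s ^ (card I - 1) * (\<Prod>p\<in>I. y p) / (\<Prod>p\<in>I. 1 + s * y p)"
proof -
  have term_eq: "(\<Prod>q\<in>I - {p}. y q / (y q - y p)) * (y p / (1 + s * y p))
      = (\<Prod>p\<in>I. y p) / s * (1 / ((\<Prod>q\<in>I - {p}. y q - y p) * (y p - - 1 / s)))"
    if "p \<in> I" for p
  proof -
    have "(\<Prod>p\<in>I. y p) = y p * (\<Prod>q\<in>I - {p}. y q)"
      using assms that by (simp add: prod.remove)
    moreover have "1 + s * y p = s * (y p - - 1 / s)"
      using assms by (simp add: field_simps)
    ultimately show ?thesis
      by (simp add: prod_dividef mult_ac)
  qed
  have "- 1 / s < 0" using \<open>s > 0\<close> by simp
  then have notin: "- 1 / s \<notin> y ` I" using assms(4) by (metis imageE less_asym)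
  have "(\<Sum>p\<in>I. (\<Prod>q\<in>I - {p}. y q / (y q - y p)) * (y p / (1 + s * y p)))
      = (\<Prod>p\<in>I. y p) / s * (1 / (\<Prod>q\<in>I. y q - - 1 / s))"
    by (simp only: term_eq sum_distrib_left[symmetric]
        partial_fractions_simple_roots[OF assms(1-3) notin] cong: sum.cong)
  also have "(\<Prod>q\<in>I. y q - - 1 / s) = (\<Prod>p\<in>I. 1 + s * y p) / s ^ card I"
  proof -
    have "(\<Prod>q\<in>I. y q - - 1 / s) = (\<Prod>q\<in>I. (1 + s * y q) / s)"
      using assms by (intro prod.cong) (auto simp: field_simps)
    then show ?thesis by (simp add: prod_dividef)
  qed
  also have "s ^ card I = s * s ^ (card I - 1)"
    using assms by (metis card_gt_0_iff power_eq_if not_gr_zero)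
  finally show ?thesis using assms by simp
qed

text \<open>The Lagrange coefficients alternate in sign along the ordered nodes, so no termwise
  bound on the logarithms can work; only the closed form of the differentiated sum has a visible
  sign.\<close>

lemma sum_lagrange_coeff_ln_less:
  fixes y :: "'a \<Rightarrow> real"
  assumes I: "finite I" "I \<noteq> {}" "inj_on y I" and pos: "\<And>p. p \<in> I \<Longrightarrow> y p > 0"
  shows "(\<Sum>p\<in>I. (\<Prod>q\<in>I - {p}. y q / (y q - y p)) * ln (1 + y p)) < (\<Prod>p\<in>I. y p) / card I"
proof -
  define a where "a p = (\<Prod>q\<in>I - {p}. y q / (y q - y p))" for p
  \<comment> \<open>Right side minus left side with every node scaled by \<open>s\<close>:
    \<open>G 0\<close> is 0 and \<open>G 1\<close> is the gap to be shown positive. Monotonicity of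
    \<open>G\<close> replaces the integration.\<close>
  define G where "G s = s ^ card I * (\<Prod>p\<in>I. y p) / card I - (\<Sum>p\<in>I. a p * ln (1 + s * y p))" for s
  have card: "card I > 0" using I by (simp add: card_gt_0_iff)
  have arg_pos: "1 + s * y p > 0" if "s \<ge> 0" "p \<in> I" for s p
    using pos[OF that(2)] that(1) by (simp add: add_pos_nonneg)
  have deriv: "(G has_real_derivative
      s ^ (card I - 1) * (\<Prod>p\<in>I. y p) - (\<Sum>p\<in>I. a p * (y p / (1 + s * y p)))) (at s)"
    if "s \<ge> 0" for s
    unfolding G_def using card arg_pos[OF that]
    by (auto intro!: derivative_eq_intros sum.cong simp: field_simps)
  have "G 0 < G 1"
  proof (rule DERIV_pos_imp_increasing_open[where f = G])
    fix s :: real assume s: "0 < s" "s < 1"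
    \<comment> \<open>Strict because \<open>I\<close> is nonempty; this is the source of the strict
      inequality.\<close>
    have "(\<Prod>p\<in>I. 1 + s * y p) > 1"
      using I s pos by (intro less_1_prod) auto
    moreover have "s ^ (card I - 1) * (\<Prod>p\<in>I. y p) > 0"
      using s pos by (simp add: prod_pos)
    ultimately have
      "s ^ (card I - 1) * (\<Prod>p\<in>I. y p) / (\<Prod>p\<in>I. 1 + s * y p) < s ^ (card I - 1) * (\<Prod>p\<in>I. y p)"
      by (metis divide_strict_left_mono div_by_1 mult.right_neutral zero_less_one mult_pos_pos less_trans)
    then show "\<exists>D. DERIV G s :> D \<and> D > 0"
      using deriv[of s] sum_lagrange_coeff_rational[OF I pos \<open>0 < s\<close>] s
      by (intro exI[of _ "s ^ (card I - 1) * (\<Prod>p\<in>I. y p) - (\<Sum>p\<in>I. a p * (y p / (1 + s * y p)))"])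
        (simp add: a_def)
  next
    show "continuous_on {0..1} G"
      by (intro continuous_at_imp_continuous_on) (auto intro: DERIV_isCont[OF deriv])
  qed simp
  then show ?thesis using card by (simp add: G_def a_def power_0_left)
qed

text \<open>Nodes of the same block i have the common factor \<open>x i\<close>, which cancels and
  leaves l / (l - j); in another block k the node product is r_k! * x_k^(r_k).\<close>

lemma expo_eq_lagrange_coeff:
  assumes "i \<in> {1..n}" "j \<in> {1..r i}" "x i \<noteq> 0"
  defines "y \<equiv> \<lambda>p. real (snd p) * x (fst p)"
  shows "expo n r x i j
    = (\<Prod>q\<in>(SIGMA i:{1..n}. {1..r i}) - {(i, j)}. y q / (y q - y (i, j)))"
proof -
  have split: "(SIGMA i:{1..n}. {1..r i}) - {(i, j)}
      = Pair i ` ({1..r i} - {j}) \<union> (SIGMA k:{1..n} - {i}. {1..r k})"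
    using assms(1) by auto
  have "(\<Prod>q\<in>Pair i ` ({1..r i} - {j}). y q / (y q - y (i, j)))
      = (\<Prod>l\<in>{1..r i} - {j}. real l / (real l - real j))"
    using assms(3) by (subst prod.reindex)
      (auto simp: inj_on_def y_def left_diff_distrib[symmetric] intro!: prod.cong)
  moreover have "(\<Prod>q\<in>(SIGMA k:{1..n} - {i}. {1..r k}). y q / (y q - y (i, j)))
      = (\<Prod>k\<in>{1..n} - {i}. \<Prod>l=1..r k. (real l * x k) / (real l * x k - real j * x i))"
    by (subst prod.Sigma) (auto simp: y_def split_def)
  moreover have "fact (r k) * x k ^ r k = (\<Prod>l=1..r k. real l * x k)" for k
    by (simp add: prod.distrib fact_prod)
  ultimately show ?thesis
    unfolding split expo_def expo_num_def expo_den_def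
    by (subst prod.union_disjoint) (auto simp: prod_dividef)
qed

text \<open>If all r_i vanish, both sides are 1 for any x_i (\<open>1 / real m\<close> is then 0),
  so the equality clause calls for m > 0. Nonzero denominators make the nodes j * x_i
  distinct.\<close>

theorem mainTheorem3:
  fixes n m :: nat and r :: "nat \<Rightarrow> nat" and x :: "nat \<Rightarrow> real"
  assumes "n \<ge> 1"
    and "inj_on x {1..n}"
    and "\<And>i. i \<in> {1..n} \<Longrightarrow> x i \<ge> 0"
    and "m = (\<Sum>i=1..n. r i)"
    and "m > 0"
    and "\<And>i j. i \<in> {1..n} \<Longrightarrow> j \<in> {1..r i} \<Longrightarrow> expo_den n r x i j \<noteq> 0"
  shows "(\<Prod>i=1..n. \<Prod>j=1..r i. (1 + real j * x i) powr expo n r x i j)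
           \<le> exp (1 / real m * (\<Prod>i=1..n. fact (r i) * x i ^ r i))
       \<and> ((\<Prod>i=1..n. \<Prod>j=1..r i. (1 + real j * x i) powr expo n r x i j)
           = exp (1 / real m * (\<Prod>i=1..n. fact (r i) * x i ^ r i))
          \<longrightarrow> (\<exists>i\<in>{1..n}. x i = 0))"
\<comment> \<open>A zero \<open>x i\<close> with \<open>r i = 0\<close> contributes no node, so it
  belongs to the strict case.\<close>
proof (cases "\<exists>i\<in>{1..n}. x i = 0 \<and> r i > 0")
  case True
  then obtain i where i: "i \<in> {1..n}" "x i = 0" "r i > 0" by blast
  have "(1 + real j * x k) powr expo n r x k j = 1" if k: "k \<in> {1..n}" for k j
  proof (cases "k = i")
    case True
    then show ?thesis using i by simp
  next
    case False
    then have "expo_num n r x k j = 0"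
      using i by (auto simp: expo_num_def intro!: bexI[of _ i])
    \<comment> \<open>\<open>powr\<close> with exponent 0 gives 1 only for a nonzero base.\<close>
    moreover have "1 + real j * x k > 0"
      using assms(3)[OF k] by (simp add: add_pos_nonneg)
    ultimately show ?thesis by (simp add: expo_def)
  qed
  moreover have "(\<Prod>i=1..n. fact (r i) * x i ^ r i) = 0"
    using i by (auto intro!: bexI[of _ i])
  ultimately have "(\<Prod>i=1..n. \<Prod>j=1..r i. (1 + real j * x i) powr expo n r x i j)
      = exp (1 / real m * (\<Prod>i=1..n. fact (r i) * x i ^ r i))"
    by simp
  then show ?thesis using i by auto
next
  case False
  define I where "I = (SIGMA i:{1..n}. {1..r i})"
  define y where "y p = real (snd p) * x (fst p)" for p :: "nat \<times> nat"
  have xpos: "x i > 0" if "i \<in> {1..n}" "j \<in> {1..r i}" for i j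
    using False assms(3)[of i] that by force
  have "finite I" "card I = m"
    by (simp_all add: I_def assms(4))
  then have "I \<noteq> {}" using \<open>m > 0\<close> by auto
  have ypos: "y p > 0" if "p \<in> I" for p
    using that xpos by (auto simp: I_def y_def)
  have "inj_on y I"
  proof (rule inj_onI, clarify)
    fix i j k l assume ij: "(i, j) \<in> I" and kl: "(k, l) \<in> I" and eq: "y (i, j) = y (k, l)"
    \<comment> \<open>A collision between different blocks would make the factor l * x_k - j * x_i
      of \<open>expo_den\<close> vanish.\<close>
    have "k = i"
    proof (rule ccontr)
      assume "k \<noteq> i"
      then have "expo_den n r x i j = 0"
        using kl eq by (force simp: I_def y_def expo_den_def)
      then show False using assms(6) ij by (auto simp: I_def)
    qed
    moreover from this have "j = l"
      using eq ij xpos[of i j] by (auto simp: I_def y_def)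
    ultimately show "i = k \<and> j = l" by simp
  qed
  have prod_y: "(\<Prod>p\<in>I. y p) = (\<Prod>i=1..n. fact (r i) * x i ^ r i)"
    unfolding I_def by (subst prod.Sigma[symmetric, where g = "\<lambda>i j. y (i, j)", simplified])
      (simp_all add: y_def prod.distrib fact_prod)
  have "(\<Prod>i=1..n. \<Prod>j=1..r i. (1 + real j * x i) powr expo n r x i j)
      = (\<Prod>p\<in>I. (1 + y p) powr expo n r x (fst p) (snd p))"
    unfolding I_def by (subst prod.Sigma) (auto simp: y_def split_def)
  also have "\<dots> = (\<Prod>p\<in>I. exp ((\<Prod>q\<in>I - {p}. y q / (y q - y p)) * ln (1 + y p)))"
  proof (rule prod.cong)
    fix p assume p: "p \<in> I"
    then have "expo n r x (fst p) (snd p) = (\<Prod>q\<in>I - {p}. y q / (y q - y p))"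
      using expo_eq_lagrange_coeff[of "fst p" n "snd p" r x] xpos[of "fst p" "snd p"]
      by (auto simp: I_def y_def)
    then show "(1 + y p) powr expo n r x (fst p) (snd p)
        = exp ((\<Prod>q\<in>I - {p}. y q / (y q - y p)) * ln (1 + y p))"
      using ypos[OF p] by (simp add: powr_def)
  qed simp
  also have "\<dots> = exp (\<Sum>p\<in>I. (\<Prod>q\<in>I - {p}. y q / (y q - y p)) * ln (1 + y p))"
    using \<open>finite I\<close> by (simp add: exp_sum)
  also have "\<dots> < exp (1 / real m * (\<Prod>i=1..n. fact (r i) * x i ^ r i))"
    using sum_lagrange_coeff_ln_less[OF \<open>finite I\<close> \<open>I \<noteq> {}\<close> \<open>inj_on y I\<close> ypos]
    by (simp add: prod_y \<open>card I = m\<close>)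
  \<comment> \<open>The inequality is strict here, so the equality clause holds vacuously.\<close>
  finally show ?thesis by simp
qed

end
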